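(* Let $q$ be a prime power, let $\theta$ be a generator of the multiplicative group $\mathbb{F}_{q^2}^\times$, and let $\mathcal{K}$ be any subset of $\mathbb{F}_q\setminus\{0\}$. Then $\mathrm{Bose}(q,\theta,\mathcal{K})$, viewed as a subset of $\mathbb{Z}_{q^2-1}$, has $|\mathcal{K}|\,q$ elements, and $$\|\mathrm{Bose}(q,\theta,\mathcal{K})\ast\mathrm{Bose}(q,\theta,\mathcal{K})\|_\infty\le 2|\mathcal{K}|^2.$$
   Context: $[n]=\{1,\dots,n\}$, $\mathbb{Z}_n$ denotes the integers modulo $n$, and $\mathbb{F}_q$ is the finite field with $q$ elements, regarded as a subfield of $\mathbb{F}_{q^2}$. For $S\subseteq\mathbb{Z}_n$ and $m\in\mathbb{Z}_n$, let $S\ast S(m)=|\{(s_1,s_2): s_1,s_2\in S,\ s_1+s_2=m\}|$ (ordered pairs, addition in $\mathbb{Z}_n$), and $\|S\ast S\|_\infty=\max_{m\in\mathbb{Z}_n}S\ast S(m)$. For $k\in\mathbb{F}_q$ define $\mathrm{Bose}(q,\theta,k)=\{a\in[q^2-1] : \theta^a-k\theta\in\mathbb{F}_q\}$, whose elements are identified with their residue classes in $\mathbb{Z}_{q^2-1}$. For $\mathcal{K}\subseteq\mathbb{F}_q\setminus\{0\}$ set $\mathrm{Bose}(q,\theta,\mathcal{K})=\bigcup_{k\in\mathcal{K}}\mathrm{Bose}(q,\theta,k)$. *)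

theory Defs
  imports
    "HOL-Algebra.Multiplicative_Group"
    "HOL-Algebra.Elementary_Groups"
    "HOL-Algebra.Generated_Groups"
    "HOL-Algebra.Subrings"
    "HOL-Number_Theory.Prime_Powers"
begin

definition self_conv :: "nat \<Rightarrow> int set \<Rightarrow> int \<Rightarrow> nat" where
  "self_conv n S m =
     card {(s1, s2). s1 \<in> S \<and> s2 \<in> S \<and> s1 \<otimes>\<^bsub>integer_mod_group n\<^esub> s2 = m}"

text \<open>Only meaningful for \<open>n > 0\<close>, where \<open>carrier (integer_mod_group n)\<close> is finite and nonempty.\<close>

definition self_conv_max :: "nat \<Rightarrow> int set \<Rightarrow> nat" where
  "self_conv_max n S = Max (self_conv n S ` carrier (integer_mod_group n))"

definition residue_classes :: "nat \<Rightarrow> nat set \<Rightarrow> int set" where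
  "residue_classes n A = (\<lambda>a. int a mod int n) ` A"

text \<open>Here \<open>R\<close> is the field with \<open>q\<^sup>2\<close> elements and \<open>F\<close> is its subfield with \<open>q\<close> elements.\<close>

definition Bose :: "('a, 'b) ring_scheme \<Rightarrow> 'a set \<Rightarrow> nat \<Rightarrow> 'a \<Rightarrow> 'a \<Rightarrow> nat set" where
  "Bose R F q \<theta> k =
     {a \<in> {1..q^2 - 1}. (\<theta> [^]\<^bsub>R\<^esub> a) \<ominus>\<^bsub>R\<^esub> (k \<otimes>\<^bsub>R\<^esub> \<theta>) \<in> F}"

definition Bose_union :: "('a, 'b) ring_scheme \<Rightarrow> 'a set \<Rightarrow> nat \<Rightarrow> 'a \<Rightarrow> 'a set \<Rightarrow> nat set" where
  "Bose_union R F q \<theta> K = (\<Union>k\<in>K. Bose R F q \<theta> k)"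

end

theory Submission
  imports Defs
begin

text \<open>
  Discrete logarithms to base \<open>\<theta>\<close> identify \<open>\<int>\<^sub>N\<close>, where \<open>N = q\<^sup>2 - 1\<close>, with the multiplicative
  group of the field, and under this identification the Bose set of \<open>K\<close> becomes
  \<open>{k\<theta> + u | k \<in> K, u \<in> F}\<close>. A generator \<open>\<theta>\<close> of the whole group cannot lie in the proper subfield
  \<open>F\<close>, so \<open>1\<close> and \<open>\<theta>\<close> are linearly independent over \<open>F\<close>
  (lemma \<open>subfield_linear_independent\<close>). Hence the \<open>|K| q\<close> elements \<open>k\<theta> + u\<close> are distinct, and
  they are nonzero because \<open>k \<noteq> 0\<close>, so each one is a power of \<open>\<theta>\<close>.

  A representation \<open>m = s + t\<close> in \<open>\<int>\<^sub>N\<close> turns into a factorization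
  \<open>(k\<theta> + u)(l\<theta> + v) = \<theta>\<^sup>m\<close>. For fixed \<open>k\<close> and \<open>l\<close> the coefficient of \<open>\<theta>\<^sup>2\<close> is fixed, so linear
  independence makes \<open>kv + lu\<close> and \<open>uv\<close> the same for all solutions. Then \<open>kv\<close> and \<open>lu\<close> have
  a prescribed sum and product, which leaves at most two possibilities
  (lemma \<open>card_linear_factorizations_le_2\<close>). Summing over the pairs \<open>(k, l)\<close> gives \<open>2|K|\<^sup>2\<close>.
\<close>

section \<open>Products of linear forms over a subfield\<close>

text \<open>The element \<open>x\<close> is a root of the polynomial \<open>(X - x')(X - y')\<close>, as the latter equals
  \<open>(X - x)(X - y)\<close>.\<close>

lemma (in domain) sum_prod_determine:
  assumes "x \<in> carrier R" "y \<in> carrier R" "x' \<in> carrier R" "y' \<in> carrier R"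
    and sum: "x \<oplus> y = x' \<oplus> y'" and prod: "x \<otimes> y = x' \<otimes> y'"
  shows "x = x' \<or> x = y'"
proof -
  have "(x \<ominus> x') \<otimes> (x \<ominus> y') = x \<otimes> x \<ominus> (x' \<oplus> y') \<otimes> x \<oplus> x' \<otimes> y'"
    using assms(1-4) by algebra
  also have "\<dots> = x \<otimes> x \<ominus> (x \<oplus> y) \<otimes> x \<oplus> x \<otimes> y"
    using sum prod by simp
  also have "\<dots> = \<zero>"
    using assms(1-4) by algebra
  finally show ?thesis
    using assms(1-4) by (metis integral_iff minus_closed r_right_minus_eq)
qed

lemma (in field) subfield_linear_independent:
  assumes F: "subfield F R" and \<theta>: "\<theta> \<in> carrier R" "\<theta> \<notin> F"
    and a: "a \<in> F" "b \<in> F" "a' \<in> F" "b' \<in> F"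
    and eq: "a \<otimes> \<theta> \<oplus> b = a' \<otimes> \<theta> \<oplus> b'"
  shows "a = a' \<and> b = b'"
proof -
  have sub: "F \<subseteq> carrier R" using F by (rule subfieldE(3))
  note sr = subfieldE(1)[OF F]
  note c = subsetD[OF sub a(1)] subsetD[OF sub a(2)] subsetD[OF sub a(3)] subsetD[OF sub a(4)]
  have "(a \<ominus> a') \<otimes> \<theta> = (a \<otimes> \<theta> \<oplus> b) \<ominus> a' \<otimes> \<theta> \<ominus> b"
    using c \<theta>(1) by algebra
  also have "\<dots> = b' \<ominus> b"
    unfolding eq using c \<theta>(1) by algebra
  finally have e: "(a \<ominus> a') \<otimes> \<theta> = b' \<ominus> b" .
  have dF: "a \<ominus> a' \<in> F" "b' \<ominus> b \<in> F"
    using a sr by (auto simp: a_minus_def intro: subringE)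
  \<comment> \<open>Otherwise \<open>\<theta>\<close> would be the quotient of \<open>b' - b\<close> by \<open>a - a'\<close>, hence in \<open>F\<close>.\<close>
  have "a \<ominus> a' = \<zero>"
  proof (rule ccontr)
    assume nz: "a \<ominus> a' \<noteq> \<zero>"
    then have i: "inv (a \<ominus> a') \<in> F" "inv (a \<ominus> a') \<otimes> (a \<ominus> a') = \<one>"
      using subfield_m_inv[OF F] dF by auto
    have "\<theta> = inv (a \<ominus> a') \<otimes> (a \<ominus> a') \<otimes> \<theta>"
      unfolding i(2) using \<theta>(1) by simp
    also have "\<dots> = inv (a \<ominus> a') \<otimes> ((a \<ominus> a') \<otimes> \<theta>)"
      using subsetD[OF sub i(1)] subsetD[OF sub dF(1)] \<theta>(1) by (rule m_assoc)
    also have "\<dots> \<in> F"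
      unfolding e using i dF subringE(6)[OF sr] by blast
    finally show False using \<theta> by blast
  qed
  then have "a = a'" using c by simp
  then show ?thesis using eq c \<theta>(1) by simp
qed

lemma (in field) card_linear_factorizations_le_2:
  assumes F: "subfield F R" and \<theta>: "\<theta> \<in> carrier R" "\<theta> \<notin> F"
    and k: "k \<in> F - {\<zero>}" "l \<in> F - {\<zero>}"
  shows "card {(u, v). u \<in> F \<and> v \<in> F \<and> (k \<otimes> \<theta> \<oplus> u) \<otimes> (l \<otimes> \<theta> \<oplus> v) = c} \<le> 2"
    (is "card ?T \<le> 2")
proof (cases "?T = {}")
  case False
  then obtain u0 v0 where 0: "(u0, v0) \<in> ?T" by auto
  have sub: "F \<subseteq> carrier R" using F by (rule subfieldE(3))
  note sr = subfieldE(1)[OF F]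
  note [simp] = subsetD[OF sub] subringE(6,7)[OF sr] \<theta>(1)
  have kl: "k \<in> F" "l \<in> F" "k \<noteq> \<zero>" "l \<noteq> \<zero>" using k by auto
  have expand: "(k \<otimes> \<theta> \<oplus> u) \<otimes> (l \<otimes> \<theta> \<oplus> v)
      = k \<otimes> l \<otimes> \<theta> \<otimes> \<theta> \<oplus> ((k \<otimes> v \<oplus> l \<otimes> u) \<otimes> \<theta> \<oplus> u \<otimes> v)"
    if "u \<in> F" "v \<in> F" for u v
  proof -
    have "u \<in> carrier R" "v \<in> carrier R" "k \<in> carrier R" "l \<in> carrier R"
      using that kl by auto
    then show ?thesis using \<theta>(1) by algebra
  qed
  have coeffs: "k \<otimes> v \<oplus> l \<otimes> u = k \<otimes> v0 \<oplus> l \<otimes> u0 \<and> u \<otimes> v = u0 \<otimes> v0"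
    if "(u, v) \<in> ?T" for u v
  proof (rule subfield_linear_independent[OF F \<theta>])
    have "k \<otimes> l \<otimes> \<theta> \<otimes> \<theta> \<oplus> ((k \<otimes> v \<oplus> l \<otimes> u) \<otimes> \<theta> \<oplus> u \<otimes> v)
        = k \<otimes> l \<otimes> \<theta> \<otimes> \<theta> \<oplus> ((k \<otimes> v0 \<oplus> l \<otimes> u0) \<otimes> \<theta> \<oplus> u0 \<otimes> v0)"
      using that 0 expand by auto
    then show "(k \<otimes> v \<oplus> l \<otimes> u) \<otimes> \<theta> \<oplus> u \<otimes> v = (k \<otimes> v0 \<oplus> l \<otimes> u0) \<otimes> \<theta> \<oplus> u0 \<otimes> v0"
      using that 0 kl by simp
  qed (use that 0 kl in auto)
  have "(\<lambda>(u, v). k \<otimes> v) ` ?T \<subseteq> {k \<otimes> v0, l \<otimes> u0}"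
  proof (rule image_subsetI)
    fix z
    assume "z \<in> ?T"
    then obtain u v where z: "z = (u, v)"
      and uv: "u \<in> F" "v \<in> F" "(k \<otimes> \<theta> \<oplus> u) \<otimes> (l \<otimes> \<theta> \<oplus> v) = c"
      by auto
    then have co: "k \<otimes> v \<oplus> l \<otimes> u = k \<otimes> v0 \<oplus> l \<otimes> u0" "u \<otimes> v = u0 \<otimes> v0"
      using coeffs[of u v] by auto
    have u0: "u0 \<in> F" "v0 \<in> F" using 0 by auto
    have "(k \<otimes> v) \<otimes> (l \<otimes> u) = k \<otimes> l \<otimes> (u \<otimes> v)" if "u \<in> F" "v \<in> F" for u v
    proof -
      have "u \<in> carrier R" "v \<in> carrier R" "k \<in> carrier R" "l \<in> carrier R"
        using that kl by auto
      then show ?thesis by algebra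
    qed
    then have "(k \<otimes> v) \<otimes> (l \<otimes> u) = (k \<otimes> v0) \<otimes> (l \<otimes> u0)"
      using co(2) uv u0 by simp
    then have "k \<otimes> v = k \<otimes> v0 \<or> k \<otimes> v = l \<otimes> u0"
      using kl uv u0 co(1) by (intro sum_prod_determine) auto
    then show "(\<lambda>(u, v). k \<otimes> v) z \<in> {k \<otimes> v0, l \<otimes> u0}"
      by (simp add: z)
  qed
  \<comment> \<open>As \<open>kv + lu\<close> is constant on the set, \<open>kv\<close> determines both \<open>u\<close> and \<open>v\<close>.\<close>
  moreover have "inj_on (\<lambda>(u, v). k \<otimes> v) ?T"
  proof (rule inj_onI)
    fix z z'
    assume "z \<in> ?T" "z' \<in> ?T" "(\<lambda>(u, v). k \<otimes> v) z = (\<lambda>(u, v). k \<otimes> v) z'"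
    then obtain u v u' v' where z: "z = (u, v)" "z' = (u', v')" and *: "u \<in> F" "v \<in> F" "(k \<otimes> \<theta> \<oplus> u) \<otimes> (l \<otimes> \<theta> \<oplus> v) = c"
      "u' \<in> F" "v' \<in> F" "(k \<otimes> \<theta> \<oplus> u') \<otimes> (l \<otimes> \<theta> \<oplus> v') = c"
      "k \<otimes> v = k \<otimes> v'"
      by auto
    then have "k \<otimes> v \<oplus> l \<otimes> u = k \<otimes> v' \<oplus> l \<otimes> u'"
      using coeffs[of u v] coeffs[of u' v'] by auto
    with * kl have "l \<otimes> u = l \<otimes> u'" by simp
    with * kl show "z = z'"
      using m_lcancel[of k v v'] m_lcancel[of l u u'] by (auto simp: z)
  qed
  ultimately have "card ?T \<le> card {k \<otimes> v0, l \<otimes> u0}"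
    by (intro card_inj_on_le) auto
  also have "\<dots> \<le> 2" by (simp add: card_insert_if)
  finally show ?thesis .
next
  case True
  then show ?thesis by (simp only: card.empty)
qed

section \<open>Bose sets\<close>

theorem mainTheorem6:
  fixes R :: "('a, 'b) ring_scheme" (structure)
    and F K :: "'a set" and q :: nat and \<theta> :: 'a
  assumes "primepow q"
    and "field R" and "card (carrier R) = q^2"
    and "subfield F R" and "card F = q"
    and "\<theta> \<in> carrier (Multiplicative_Group.mult_of R)"
    and "generate (Multiplicative_Group.mult_of R) {\<theta>} = carrier (Multiplicative_Group.mult_of R)"
    and "K \<subseteq> F - {\<zero>}"
  shows "card (residue_classes (q^2 - 1) (Bose_union R F q \<theta> K)) = card K * q
       \<and> self_conv_max (q^2 - 1) (residue_classes (q^2 - 1) (Bose_union R F q \<theta> K)) \<le> 2 * (card K)^2"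
proof -
  interpret field R by fact
  interpret M: group "mult_of R" by (rule field_mult_group)
  define N where "N = q\<^sup>2 - 1"
  have sub: "F \<subseteq> carrier R" using assms(4) by (rule subfieldE(3))
  note sr = subfieldE(1)[OF assms(4)]
  have q2: "q \<ge> 2" using assms(1) primepow_gt_Suc_0[of q] by simp
  then have qq: "q < q\<^sup>2" "q\<^sup>2 > 0" by (auto simp: power2_eq_square)
  have fin: "finite (carrier R)" "finite F"
    using assms(3,5) q2 by (metis card.infinite not_numeral_le_zero power_eq_0_iff)+
  have Npos: "N > 0" using qq q2 unfolding N_def by linarith
  have \<theta>: "\<theta> \<in> carrier R" "\<theta> \<noteq> \<zero>" using assms(6) by auto
  have cardM: "card (carrier (mult_of R)) = N"
    using fin assms(3) by (simp add: N_def card_Diff_subset)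
  have "\<theta> \<notin> F"
  proof
    assume "\<theta> \<in> F"
    then have "generate (mult_of R) {\<theta>} \<subseteq> F - {\<zero>}"
    proof -
      have "\<theta> [^] n \<in> F" for n :: nat
        using \<open>\<theta> \<in> F\<close> subringE(3,6)[OF sr] by (induction n) auto
      moreover have "generate (mult_of R) {\<theta>} = {\<theta> [^]\<^bsub>mult_of R\<^esub> n | n. n \<in> (UNIV :: nat set)}"
        using fin by (intro M.generate_pow_on_finite_carrier assms(6)) simp
      ultimately show ?thesis
        using assms(7) by (auto simp: nat_pow_mult_of)
    qed
    then have "card (carrier (mult_of R)) \<le> card (F - {\<zero>})"
      using assms(7) fin by (metis card_mono finite_Diff)
    also have "\<dots> \<le> q" using assms(5) fin by (metis card_mono Diff_subset)
    finally have "N \<le> q" using cardM by simp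
    moreover have "q * q \<ge> 2 * q" using q2 by simp
    ultimately show False using q2 unfolding N_def power2_eq_square by linarith
  qed
  have ord: "M.ord \<theta> = N"
    using M.generate_pow_card[of \<theta>] assms(6,7) cardM fin by simp
  have pow_mod: "\<theta> [^] (a mod N) = \<theta> [^] a" for a :: nat
  proof -
    have "\<theta> [^] N = \<one>"
      using M.pow_ord_eq_1[OF assms(6)] by (simp add: ord nat_pow_mult_of)
    then have "\<theta> [^] (N * (a div N)) = \<one>"
      using \<theta>(1) by (simp flip: nat_pow_pow)
    then have "\<theta> [^] (N * (a div N) + a mod N) = \<theta> [^] (a mod N)"
      using \<theta>(1) nat_pow_mult[of \<theta> "N * (a div N)" "a mod N"] by simp
    then show ?thesis by simp
  qed
  \<comment> \<open>Exponentiation on \<open>\<int>\<^sub>N\<close>, whose elements are represented by \<open>0, \<dots>, N - 1\<close>.\<close>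
  define p where "p s = \<theta> [^] nat s" for s :: int
  have p_mod: "p (int a mod int N) = \<theta> [^] a" for a
    by (simp add: p_def pow_mod nat_mod_distrib)
  have p_mult: "p ((s + t) mod int N) = p s \<otimes> p t" if st: "s \<ge> 0" "t \<ge> 0" for s t
  proof -
    obtain a b where "s = int a" "t = int b"
      using st zero_le_imp_eq_int by blast
    then show ?thesis
      using p_mod[of "a + b"] \<theta>(1) by (simp add: p_def nat_pow_mult)
  qed
  have p_inj: "inj_on p {0..<int N}"
  proof (rule inj_onI)
    fix s t assume st: "s \<in> {0..<int N}" "t \<in> {0..<int N}" "p s = p t"
    then have "nat s = nat t"
      using inj_onD[OF M.ord_inj[OF assms(6)], of "nat s" "nat t"]
      by (auto simp: ord p_def nat_pow_mult_of)
    then show "s = t" using st by (simp add: eq_nat_nat_iff)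
  qed
  have p_surj: "\<exists>a\<in>{1..N}. \<theta> [^] a = x" if "x \<in> carrier R" "x \<noteq> \<zero>" for x
  proof -
    have "(\<lambda>a. \<theta> [^] a) ` {1..N} = carrier (mult_of R)"
    proof (rule card_subset_eq)
      show "card ((\<lambda>a. \<theta> [^] a) ` {1..N}) = card (carrier (mult_of R))"
        unfolding cardM using M.ord_inj'[OF assms(6)] by (simp add: card_image ord nat_pow_mult_of)
      show "(\<lambda>a. \<theta> [^] a) ` {1..N} \<subseteq> carrier (mult_of R)"
        using M.nat_pow_closed[OF assms(6)] by (auto simp: nat_pow_mult_of)
    qed (use fin in simp)
    moreover have "x \<in> carrier (mult_of R)" using that by simp
    ultimately show ?thesis by (metis imageE)
  qed
  define f where "f = (\<lambda>(k, u). k \<otimes> \<theta> \<oplus> u)"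
  define S where "S = residue_classes N (Bose_union R F q \<theta> K)"
  have KF: "K \<subseteq> F" "\<zero> \<notin> K" using assms(8) by auto
  have finK: "finite K" using KF fin by (metis finite_subset)
  have S_sub: "S \<subseteq> {0..<int N}"
    using Npos by (auto simp: S_def residue_classes_def)
  have f_inj: "inj_on f (K \<times> F)"
  proof (rule inj_onI)
    fix z z' assume "z \<in> K \<times> F" "z' \<in> K \<times> F" "f z = f z'"
    then obtain k u k' u' where z: "z = (k, u)" "z' = (k', u')"
      and "k \<in> K" "u \<in> F" "k' \<in> K" "u' \<in> F" "k \<otimes> \<theta> \<oplus> u = k' \<otimes> \<theta> \<oplus> u'"
      by (auto simp: f_def)
    then have "k = k' \<and> u = u'"
      using KF by (intro subfield_linear_independent[OF assms(4) \<theta>(1) \<open>\<theta> \<notin> F\<close>]) auto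
    then show "z = z'" by (simp add: z)
  qed
  have pS: "p ` S = f ` (K \<times> F)"
  proof
    show "p ` S \<subseteq> f ` (K \<times> F)"
    proof
      fix x assume "x \<in> p ` S"
      then obtain a :: nat and k where a: "k \<in> K" "\<theta> [^] a \<ominus> k \<otimes> \<theta> \<in> F" "x = \<theta> [^] a"
        by (auto simp: S_def residue_classes_def Bose_union_def Bose_def p_mod)
      have "k \<in> carrier R" "x \<in> carrier R" using a KF sub \<theta>(1) by auto
      then have "x = k \<otimes> \<theta> \<oplus> (x \<ominus> k \<otimes> \<theta>)"
        using \<theta>(1) by algebra
      then have "x = f (k, x \<ominus> k \<otimes> \<theta>)"
        by (simp add: f_def)
      then show "x \<in> f ` (K \<times> F)" using a by blast
    qed
    show "f ` (K \<times> F) \<subseteq> p ` S"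
    proof clarify
      fix k u assume ku: "k \<in> K" "u \<in> F"
      then have c: "k \<in> carrier R" "u \<in> carrier R" "k \<noteq> \<zero>" using KF sub by auto
      have "k \<otimes> \<theta> \<oplus> u \<noteq> \<zero> \<otimes> \<theta> \<oplus> \<zero>"
        using subfield_linear_independent[OF assms(4) \<theta>(1) \<open>\<theta> \<notin> F\<close>, of k u \<zero> \<zero>]
          ku KF c(3) subringE(2)[OF sr] by blast
      then have "f (k, u) \<noteq> \<zero>" using \<theta>(1) by (simp add: f_def)
      then obtain a :: nat where a: "a \<in> {1..N}" "\<theta> [^] a = f (k, u)"
        using p_surj[of "f (k, u)"] c \<theta>(1) by (auto simp: f_def)
      have "f (k, u) \<ominus> k \<otimes> \<theta> = u"
        unfolding f_def split_conv using c \<theta>(1) by algebra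
      then have "a \<in> Bose R F q \<theta> k"
        using a ku by (simp add: Bose_def N_def)
      then have "a \<in> Bose_union R F q \<theta> K"
        using ku(1) by (auto simp: Bose_union_def)
      then have "int a mod int N \<in> S" by (auto simp: S_def residue_classes_def)
      then show "f (k, u) \<in> p ` S"
        using a(2) p_mod[of a] by (metis imageI)
    qed
  qed
  have "card S = card (p ` S)"
    using inj_on_subset[OF p_inj S_sub] by (simp add: card_image)
  also have "\<dots> = card K * q"
    unfolding pS using f_inj assms(5) by (simp add: card_image card_cartesian_product)
  finally have card: "card S = card K * q" .
  have conv: "self_conv N S m \<le> 2 * (card K)\<^sup>2" for m
  proof -
    \<comment> \<open>The map \<open>p \<times> p\<close> embeds the representations of \<open>m\<close> into the factorizations of \<open>p m\<close>.\<close>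
    define P where "P = {(s, t). s \<in> S \<and> t \<in> S \<and> (s + t) mod int N = m}"
    define T where "T = (\<lambda>(k, l). {(u, v). u \<in> F \<and> v \<in> F \<and> f (k, u) \<otimes> f (l, v) = p m})"
    define g where "g = (\<lambda>((k, l), (u, v)). (f (k, u), f (l, v)))"
    have finT: "finite (T kl)" for kl
      by (rule finite_subset[of _ "F \<times> F"]) (use fin in \<open>auto simp: T_def\<close>)
    have finS: "finite (Sigma (K \<times> K) T)"
      using finK finT by blast
    have "map_prod p p ` P \<subseteq> g ` Sigma (K \<times> K) T"
    proof (rule image_subsetI)
      fix z assume "z \<in> P"
      then obtain s t where z: "z = (s, t)"
        and st: "s \<in> S" "t \<in> S" "m = (s + t) mod int N"
        by (auto simp: P_def)
      have "p s \<in> f ` (K \<times> F)" "p t \<in> f ` (K \<times> F)"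
        using st(1,2) by (simp_all flip: pS)
      then obtain k u l v where ku: "k \<in> K" "u \<in> F" "p s = f (k, u)"
        and lv: "l \<in> K" "v \<in> F" "p t = f (l, v)"
        by blast
      have "s \<ge> 0" "t \<ge> 0"
        using st(1,2) S_sub by auto
      then have "p m = f (k, u) \<otimes> f (l, v)"
        using p_mult[of s t] by (simp add: st(3) ku(3) lv(3))
      then have "((k, l), (u, v)) \<in> Sigma (K \<times> K) T"
        using ku lv by (auto simp: T_def)
      then show "map_prod p p z \<in> g ` Sigma (K \<times> K) T"
        by (rule rev_image_eqI) (simp add: z g_def ku lv)
    qed
    moreover have "inj_on (map_prod p p) P"
      by (rule inj_on_subset[OF map_prod_inj_on[OF p_inj p_inj]]) (use S_sub in \<open>auto simp: P_def\<close>)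
    ultimately have "card P \<le> card (g ` Sigma (K \<times> K) T)"
      using finS by (intro card_inj_on_le) auto
    also have "\<dots> \<le> card (Sigma (K \<times> K) T)"
      using finS by (rule card_image_le)
    also have "\<dots> = (\<Sum>kl\<in>K \<times> K. card (T kl))"
      using finK finT by simp
    also have "\<dots> \<le> (\<Sum>kl\<in>K \<times> K. 2)"
    proof (rule sum_mono, clarify)
      fix k l assume "k \<in> K" "l \<in> K"
      then show "card (T (k, l)) \<le> 2"
        using card_linear_factorizations_le_2[OF assms(4) \<theta>(1) \<open>\<theta> \<notin> F\<close>, of k l "p m"] assms(8)
        by (auto simp: T_def f_def)
    qed
    also have "\<dots> = 2 * (card K)\<^sup>2"
      by (simp add: card_cartesian_product power2_eq_square)
    finally show ?thesis
      by (simp add: self_conv_def P_def)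
  qed
  have "self_conv_max N S \<le> 2 * (card K)\<^sup>2"
    unfolding self_conv_max_def using conv Npos
    by (subst Max_le_iff) (auto simp: carrier_integer_mod_group)
  with card show ?thesis by (simp add: S_def N_def)
qed

end
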